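(* Let $\mathbf{u}=(u_1,u_2)$ and $\mathbf{v}=(v_1,v_2)$ be smooth maps $\mathbb{R}\to\mathbb{S}^1$ with $u_1(x)<0$, $u_2(x)>0$, $v_1(x)>0$, $v_2(x)>0$ for all $x\in\mathbb{R}$. Assume that $\mathbf{u}$ and $\mathbf{v}$ (viewed as vector fields along $\mathbb{R}\times\{0\}$) are extended to smooth vector fields on $\mathbb{R}^2$, still denoted $\mathbf{u}$ and $\mathbf{v}$, so that their integral curves are straight lines, and that $\mathbf{u}$ and $\mathbf{v}$ are linearly independent at every point. Let $f\in C^\infty_c(\mathbb{R}^2_+)$ be a function with $\operatorname{supp}(f)\subseteq\{y>0\}$ satisfying $$\operatorname{div}(\mathbf{u}(x,y))\int_0^\infty f\big((x,y)+t\,\mathbf{u}(x,y)\big)\,dt-\operatorname{div}(\mathbf{v}(x,y))\int_0^\infty f\big((x,y)+t\,\mathbf{v}(x,y)\big)\,dt=0$$ for all $(x,y)\in\mathbb{R}^2_+$. Then the following statements are equivalent: (i) $\mathcal{R}f(x,d)=0$ for all $(x,d)\in\mathbb{R}^2_+$. (ii) There is a function $\varphi\in C^\infty_c(\mathbb{R}^2_+)$ vanishing on $\mathbb{R}\times\{0\}$ such that $$f(x,y)=P_{\mathbf{u}}(x,y)\big[\det(A_{\mathbf{u},\mathbf{v}}(x,y))^{-1}P_{\mathbf{v}}(x,y)\varphi(x,y)\big]$$ and also $$f(x,y)=P_{\mathbf{v}}(x,y)\big[\det(A_{\mathbf{u},\mathbf{v}}(x,y))^{-1}P_{\mathbf{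u}}(x,y)\varphi(x,y)\big].$$
   Context: Notation: $\mathbb{R}_+=\{x\in\mathbb{R}: x\ge 0\}$, $\mathbb{R}^2_+=\mathbb{R}\times\mathbb{R}_+$ (closed half-plane), $\mathbb{S}^1$ is the unit circle in $\mathbb{R}^2$. The extended fields agree with the original ones on $\mathbb{R}\times\{0\}$: $\mathbf{u}(x,0)=\mathbf{u}(x)$, $\mathbf{v}(x,0)=\mathbf{v}(x)$. The head-wave transform of $f:\mathbb{R}^2_+\to\mathbb{R}$ is the function $\mathcal{R}f:\mathbb{R}\times\mathbb{R}_+\to\mathbb{R}$, $$\mathcal{R}f(x,d)=\int_0^\infty f\big((x,0)+t\,\mathbf{u}(x,0)\big)\,dt+\int_0^d f(x+t,0)\,dt+\int_0^\infty f\big((x+d,0)+t\,\mathbf{v}(x+d,0)\big)\,dt.$$ The variable coefficient differential operators are $P_{\mathbf{u}}(x,y)=\mathbf{u}(x,y)\cdot\nabla$ and $P_{\mathbf{v}}(x,y)=\mathbf{v}(x,y)\cdot\nabla$, and $$A_{\mathbf{u},\mathbf{v}}(x,y)=\begin{pmatrix}u_1(x,y)&v_1(x,y)\\ u_2(x,y)&v_2(x,y)\end{pmatrix}.$$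
   Formalization: φ is required to extend by zero to a smooth function on R², so all its derivatives vanish on R×{0}; with φ merely smooth up to the boundary, (ii) does not imply (i). Straight integral curves are read as lines traversed with constant velocity (arbitrary speed makes the claim false). *)

theory Defs
  imports "HOL-Analysis.Analysis"
begin

(* Differentiability at every order of the iterated directional derivatives; on a Euclidean
   space and quantified over k this is membership in C^\<infinity>. *)
primrec Ck :: "nat \<Rightarrow> ('a::real_normed_vector \<Rightarrow> 'b::real_normed_vector) \<Rightarrow> bool" where
  "Ck 0 g \<longleftrightarrow> continuous_on UNIV g"
| "Ck (Suc k) g \<longleftrightarrow> (\<forall>x. g differentiable at x) \<and> (\<forall>h. Ck k (\<lambda>x. frechet_derivative g (at x) h))"

definition smooth :: "('a::real_normed_vector \<Rightarrow> 'b::real_normed_vector) \<Rightarrow> bool" where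
  "smooth g \<longleftrightarrow> (\<forall>k. Ck k g)"

definition supp :: "('a::topological_space \<Rightarrow> real) \<Rightarrow> 'a set" where
  "supp g = closure {p. g p \<noteq> 0}"

(* For closed S these are the smooth functions on the whole space whose support is a compact
   subset of S, so every derivative of g vanishes on the boundary of S. *)
definition Cc_smooth :: "'a::real_normed_vector set \<Rightarrow> ('a \<Rightarrow> real) set" where
  "Cc_smooth S = {g. smooth g \<and> compact (supp g) \<and> supp g \<subseteq> S}"

definition half_plane :: "(real \<times> real) set" where
  "half_plane = UNIV \<times> {0..}"

definition grad :: "(real \<times> real \<Rightarrow> real) \<Rightarrow> real \<times> real \<Rightarrow> real \<times> real" where
  "grad g p = (frechet_derivative g (at p) (1, 0), frechet_derivative g (at p) (0, 1))"

definition divergence :: "(real \<times> real \<Rightarrow> real \<times> real) \<Rightarrow> real \<times> real \<Rightarrow> real" where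
  "divergence X p =
     fst (frechet_derivative X (at p) (1, 0)) + snd (frechet_derivative X (at p) (0, 1))"

definition P_op ::
  "(real \<times> real \<Rightarrow> real \<times> real) \<Rightarrow> (real \<times> real \<Rightarrow> real) \<Rightarrow> real \<times> real \<Rightarrow> real" where
  "P_op X g p = X p \<bullet> grad g p"

definition A_mat ::
  "(real \<times> real \<Rightarrow> real \<times> real) \<Rightarrow> (real \<times> real \<Rightarrow> real \<times> real) \<Rightarrow> real \<times> real \<Rightarrow> real ^ 2 ^ 2" where
  "A_mat U V p = vector [vector [fst (U p), fst (V p)], vector [snd (U p), snd (V p)]]"

definition integral_curve ::
  "('a::real_normed_vector \<Rightarrow> 'a) \<Rightarrow> (real \<Rightarrow> 'a) \<Rightarrow> bool" where
  "integral_curve X \<gamma> \<longleftrightarrow> (\<forall>t. (\<gamma> has_vector_derivative X (\<gamma> t)) (at t))"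

(* A straight line is traversed as a curve with constant velocity, as in the integrals of
   f (p + t X p): the integral curve through p is t \<mapsto> p + t X p. *)
definition straight_integral_curves :: "('a::real_normed_vector \<Rightarrow> 'a) \<Rightarrow> bool" where
  "straight_integral_curves X \<longleftrightarrow>
     (\<forall>p. \<exists>\<gamma>. integral_curve X \<gamma> \<and> \<gamma> 0 = p) \<and>
     (\<forall>\<gamma>. integral_curve X \<gamma> \<longrightarrow> (\<exists>p w. \<forall>t. \<gamma> t = p + t *\<^sub>R w))"

definition ray_integral ::
  "(real \<times> real \<Rightarrow> real \<times> real) \<Rightarrow> (real \<times> real \<Rightarrow> real) \<Rightarrow> real \<times> real \<Rightarrow> real" where
  "ray_integral X f p = integral {0..} (\<lambda>t. f (p + t *\<^sub>R X p))"

definition head_wave_transform ::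
  "(real \<times> real \<Rightarrow> real \<times> real) \<Rightarrow> (real \<times> real \<Rightarrow> real \<times> real) \<Rightarrow>
     (real \<times> real \<Rightarrow> real) \<Rightarrow> real \<Rightarrow> real \<Rightarrow> real" where
  "head_wave_transform U V f x d =
     ray_integral U f (x, 0) + integral {0..d} (\<lambda>t. f (x + t, 0)) + ray_integral V f (x + d, 0)"

end

theory Submission
  imports Defs
begin

text \<open>Fields with complete straight integral curves on the whole plane that cross the axis with
  unit speed are constant, so \<open>U = a\<close>, \<open>V = b\<close> and the divergence condition is void. If the
  transform vanishes, moving \<open>d\<close> far to the right separates the two ray integrals, which then vanish
  on the axis and, along the rays, everywhere below it. The potential is \<open>\<phi> = det * G\<close>, where \<open>G\<close> is the
  iterated ray integral of \<open>f\<close> along \<open>a\<close> and then \<open>b\<close>. Its derivatives along \<open>a\<close> and \<open>b\<close> are the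
  negated ray integrals along \<open>b\<close> and \<open>a\<close>; as both vanish below the axis, \<open>G\<close> is constant on
  horizontal lines there, hence zero. Conversely, the two formulas integrate along the rays to a
  first derivative of \<open>\<phi>\<close> on the axis, which is zero because \<open>\<phi>\<close> vanishes below.\<close>

section \<open>Smooth functions, supports and directional derivatives\<close>

lemma Ck_imp_continuous:
  fixes g :: "'a::real_normed_vector \<Rightarrow> 'b::real_normed_vector"
  assumes "Ck k g"
  shows "continuous_on UNIV g"
proof (cases k)
  case 0
  then show ?thesis using assms by simp
next
  case (Suc n)
  then show ?thesis
    using assms by (auto intro: continuous_at_imp_continuous_on differentiable_imp_continuous_within)
qed

lemma smooth_imp_differentiable: "smooth g \<Longrightarrow> g differentiable at x"
  unfolding smooth_def by (metis Ck.simps(2))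

lemma smooth_frechet_derivative:
  "smooth g \<Longrightarrow> smooth (\<lambda>x. frechet_derivative g (at x) h)"
  unfolding smooth_def by (metis Ck.simps(2))

lemma frechet_derivative_scale:
  fixes g :: "'a::real_normed_vector \<Rightarrow> real"
  assumes "g differentiable at x"
  shows "frechet_derivative (\<lambda>x. c * g x) (at x) h = c * frechet_derivative g (at x) h"
proof -
  have "((\<lambda>x. c * g x) has_derivative (\<lambda>h. c * frechet_derivative g (at x) h)) (at x)"
    using assms frechet_derivative_works by (intro has_derivative_mult_right) blast
  then show ?thesis
    by (metis frechet_derivative_at)
qed

lemma Ck_scale:
  fixes g :: "'a::real_normed_vector \<Rightarrow> real"
  shows "Ck k g \<Longrightarrow> Ck k (\<lambda>x. c * g x)"
proof (induction k arbitrary: g)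
  case 0
  then show ?case by (simp add: continuous_on_mult_left)
next
  case (Suc k)
  then have d: "g differentiable at x" for x by simp
  have "Ck k (\<lambda>x. frechet_derivative (\<lambda>x. c * g x) (at x) h)" for h
    unfolding frechet_derivative_scale[OF d] using Suc by simp
  moreover have "(\<lambda>x. c * g x) differentiable at x" for x
    using d by (intro differentiable_mult) auto
  ultimately show ?case by simp
qed

lemma smooth_scale:
  fixes g :: "'a::real_normed_vector \<Rightarrow> real"
  shows "smooth g \<Longrightarrow> smooth (\<lambda>x. c * g x)"
  unfolding smooth_def by (simp add: Ck_scale)

lemma frechet_derivative_has_real_derivative_along:
  fixes g :: "'a::real_normed_vector \<Rightarrow> real"
  assumes "g differentiable at (p + t *\<^sub>R w)"
  shows "((\<lambda>t. g (p + t *\<^sub>R w)) has_real_derivative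
           frechet_derivative g (at (p + t *\<^sub>R w)) w) (at t within S)"
proof -
  let ?D = "frechet_derivative g (at (p + t *\<^sub>R w))"
  have D: "(g has_derivative ?D) (at (p + t *\<^sub>R w))"
    using assms frechet_derivative_works by blast
  have "((\<lambda>t. p + t *\<^sub>R w) has_derivative (\<lambda>s. s *\<^sub>R w)) (at t within S)"
    by (auto intro!: derivative_eq_intros)
  then have "((\<lambda>t. g (p + t *\<^sub>R w)) has_derivative (\<lambda>s. ?D (s *\<^sub>R w))) (at t within S)"
    using has_derivative_compose D by blast
  moreover have "?D (s *\<^sub>R w) = ?D w * s" for s
    using linear_cmul[OF has_derivative_linear[OF D]] by simp
  ultimately show ?thesis
    by (simp add: has_field_derivative_def)
qed

lemma eq_0_outside_supp: "p \<notin> supp g \<Longrightarrow> g p = 0"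
  using closure_subset[of "{p. g p \<noteq> 0}"] unfolding supp_def by auto

lemma norm_le_if_supp_subset_cball: "supp g \<subseteq> cball 0 B \<Longrightarrow> g p \<noteq> 0 \<Longrightarrow> norm p \<le> B"
  by (metis eq_0_outside_supp mem_cball_0 subsetD)

lemma frechet_derivative_eq_0_outside_supp:
  fixes g :: "'a::real_normed_vector \<Rightarrow> real"
  assumes "p \<notin> supp g"
  shows "frechet_derivative g (at p) h = 0"
proof -
  have "open (- supp g)" unfolding supp_def by (rule open_Compl[OF closed_closure])
  then have "(g has_derivative (\<lambda>_. 0)) (at p)"
    using assms by (intro has_derivative_transform_within_open[OF has_derivative_const, of "-supp g"])
      (auto simp: eq_0_outside_supp)
  then show ?thesis by (metis frechet_derivative_at)
qed

lemma norm_le_if_frechet_derivative_neq_0: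
  fixes g :: "'a::real_normed_vector \<Rightarrow> real"
  shows "supp g \<subseteq> cball 0 B \<Longrightarrow> frechet_derivative g (at p) h \<noteq> 0 \<Longrightarrow> norm p \<le> B"
  by (metis frechet_derivative_eq_0_outside_supp mem_cball_0 subsetD)

text \<open>Once both fields are known to be constant, this turns the operators into directional
  derivatives, which need no coordinates.\<close>

lemma P_op_const:
  assumes "g differentiable at p"
  shows "P_op (\<lambda>_. w) g p = frechet_derivative g (at p) w"
proof -
  have lin: "linear (frechet_derivative g (at p))"
    using assms by (simp add: linear_frechet_derivative)
  have "w = fst w *\<^sub>R (1, 0) + snd w *\<^sub>R (0, 1)"
    by (simp add: prod_eq_iff)
  then have "frechet_derivative g (at p) w
      = frechet_derivative g (at p) (fst w *\<^sub>R (1, 0) + snd w *\<^sub>R (0, 1))" by simp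
  then show ?thesis
    unfolding linear_add[OF lin] linear_cmul[OF lin]
    by (simp add: P_op_def grad_def inner_prod_def)
qed

section \<open>Rigidity of fields with straight integral curves\<close>

text \<open>Two non-parallel integral lines would meet, and the field would take both velocities at
  the intersection point. So all integral lines are parallel; each of them crosses the axis, where
  the field is normalised.\<close>

lemma straight_integral_curves_const:
  fixes X :: "real \<times> real \<Rightarrow> real \<times> real"
  assumes straight: "straight_integral_curves X"
    and nz: "\<And>p. X p \<noteq> 0"
    and unit: "\<And>x. norm (X (x, 0)) = 1" and up: "\<And>x. snd (X (x, 0)) > 0"
  shows "X = (\<lambda>_. X (0, 0))"
proof -
  \<comment> \<open>An affine curve has constant velocity, so the field keeps one value along each
    integral line.\<close>
  have inv: "X (p + t *\<^sub>R X p) = X p" for p t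
  proof -
    obtain \<gamma> where \<gamma>: "integral_curve X \<gamma>" "\<gamma> 0 = p"
      using straight unfolding straight_integral_curves_def by blast
    then obtain p' w where l: "\<And>t. \<gamma> t = p' + t *\<^sub>R w"
      using straight unfolding straight_integral_curves_def by blast
    have w: "X (\<gamma> t) = w" for t
    proof -
      have "(\<gamma> has_vector_derivative w) (at t)"
        unfolding l[abs_def] by (auto intro!: derivative_eq_intros)
      then show ?thesis
        using \<gamma>(1) unfolding integral_curve_def by (metis vector_derivative_at)
    qed
    show ?thesis using w[of t] w[of 0] \<gamma>(2) l[of 0] l[of t] by simp
  qed
  have par: "fst (X p) * snd (X q) = snd (X p) * fst (X q)" for p q
  proof (rule ccontr)
    assume neq: "\<not> ?thesis"
    define c where "c = fst (X p) * snd (X q) - snd (X p) * fst (X q)"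
    \<comment> \<open>Cramer's rule for the intersection of the lines through \<open>p\<close> and
      \<open>q\<close>; \<open>c\<close> is the determinant of the two directions.\<close>
    define s where "s = (fst (q - p) * snd (X q) - snd (q - p) * fst (X q)) / c"
    define t where "t = (fst (q - p) * snd (X p) - snd (q - p) * fst (X p)) / c"
    have "c \<noteq> 0" using neq by (simp add: c_def)
    then have "p + s *\<^sub>R X p = q + t *\<^sub>R X q"
      unfolding s_def t_def
      by (simp add: prod_eq_iff field_simps) (simp add: c_def algebra_simps)
    then have "X p = X q" using inv by metis
    then show False using neq by simp
  qed
  have axis: "X (x, 0) = X (0, 0)" for x
  proof -
    let ?a = "X (x, 0)" and ?b = "X (0, 0)"
    have n: "(fst ?a)\<^sup>2 + (snd ?a)\<^sup>2 = 1" "(fst ?b)\<^sup>2 + (snd ?b)\<^sup>2 = 1"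
      using unit[of x] unit[of 0] by (simp_all add: norm_prod_def)
    \<comment> \<open>Squaring the parallelism relation allows the first components to be eliminated
      by the unit norms. What is left determines the second components up to sign, and both are
      positive.\<close>
    have "(fst ?a * snd ?b)\<^sup>2 = (snd ?a * fst ?b)\<^sup>2" using par by simp
    then have "(snd ?a)\<^sup>2 = (snd ?b)\<^sup>2"
      using n by (simp add: power_mult_distrib) algebra
    then have "snd ?a = snd ?b" using up[of x] up[of 0] by (simp add: power2_eq_iff_nonneg)
    then show ?thesis using par[of "(x, 0)" "(0, 0)"] up[of 0] by (simp add: prod_eq_iff)
  qed
  have "X p = X (0, 0)" for p
  proof -
    \<comment> \<open>A nonzero vector parallel to the non-horizontal \<open>X (0, 0)\<close> is not
      horizontal, so the line through \<open>p\<close> reaches the axis, at time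
      \<open>- snd p / snd (X p)\<close>.\<close>
    have "snd (X p) \<noteq> 0"
      using par[of p "(0, 0)"] up[of 0] nz[of p] by (auto simp: prod_eq_iff)
    then have "p + (- snd p / snd (X p)) *\<^sub>R X p = (fst p - snd p / snd (X p) * fst (X p), 0)"
      by (simp add: prod_eq_iff)
    then show ?thesis using inv[of p "- snd p / snd (X p)"] axis by metis
  qed
  then show ?thesis by blast
qed

section \<open>Ray integrals as integrals over bounded intervals, and their regularity\<close>

lemma compact_imp_subset_cball:
  fixes K :: "'a::real_normed_vector set"
  assumes "compact K"
  shows "\<exists>B. K \<subseteq> cball 0 B"
  using compact_imp_bounded[OF assms] unfolding bounded_iff subset_iff mem_cball_0 by blast

lemma abs_fst_le_norm: "\<bar>fst p\<bar> \<le> norm (p :: real \<times> real)"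
  by (metis norm_fst_le prod.collapse real_norm_def)

lemma abs_snd_le_norm: "\<bar>snd p\<bar> \<le> norm (p :: real \<times> real)"
  by (metis norm_snd_le prod.collapse real_norm_def)

lemma ray_point_outside:
  assumes "w \<noteq> 0" "norm p \<le> r" "(r + B) / norm w < t"
  shows "norm (p + t *\<^sub>R w) > B"
proof -
  have *: "r + B < t * norm w" using assms by (simp add: pos_divide_less_eq)
  have "t * norm w \<le> norm (t *\<^sub>R w)" by (simp add: mult_right_mono)
  also have "\<dots> \<le> norm (p + t *\<^sub>R w) + norm p"
    using norm_triangle_ineq4[of "p + t *\<^sub>R w" p] by simp
  finally show ?thesis using * assms(2) by linarith
qed

text \<open>By the reverse triangle inequality the ray has left the ball of radius \<open>B\<close>
  after the stated time. This time depends on \<open>p\<close> only through the bound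
  \<open>r\<close>, so one finite interval serves a whole ball of base points and theorems on
  parameter integrals apply.\<close>

lemma ray_integral_cutoff:
  assumes "w \<noteq> 0" "norm p \<le> r" and B: "\<And>q. g q \<noteq> 0 \<Longrightarrow> norm q \<le> B"
  shows "ray_integral (\<lambda>_. w) g p = integral {0..(r + B) / norm w} (\<lambda>t. g (p + t *\<^sub>R w))"
proof -
  have "g (p + t *\<^sub>R w) = 0" if "t > (r + B) / norm w" for t
    using ray_point_outside[OF assms(1,2) that] B[of "p + t *\<^sub>R w"] by fastforce
  then have eq: "(\<lambda>t. if t \<in> {0..} then g (p + t *\<^sub>R w) else 0)
      = (\<lambda>t. if t \<in> {0..(r + B) / norm w} then g (p + t *\<^sub>R w) else 0)"
    by (auto simp: fun_eq_iff not_le)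
  show ?thesis
    using Henstock_Kurzweil_Integration.integral_restrict_UNIV[of "{0..}" "\<lambda>t. g (p + t *\<^sub>R w)"]
    unfolding eq Henstock_Kurzweil_Integration.integral_restrict_UNIV ray_integral_def by simp
qed

text \<open>The fundamental theorem of calculus along the ray: the far endpoint lies where
  \<open>g\<close> vanishes, so only the term at \<open>p\<close> survives.\<close>

lemma ray_integral_frechet_derivative:
  fixes g :: "real \<times> real \<Rightarrow> real"
  assumes d: "\<And>q. g differentiable at q" and w: "w \<noteq> 0"
    and B: "\<And>q. g q \<noteq> 0 \<Longrightarrow> norm q \<le> B"
    and DB: "\<And>q. frechet_derivative g (at q) w \<noteq> 0 \<Longrightarrow> norm q \<le> B"
  shows "ray_integral (\<lambda>_. w) (\<lambda>q. frechet_derivative g (at q) w) p = - g p"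
proof -
  \<comment> \<open>The excess over \<open>norm p\<close> places the endpoint strictly beyond the
    cutoff time, and adding the absolute value of \<open>B\<close> keeps \<open>T\<close>
    nonnegative for every sign of \<open>B\<close>.\<close>
  define r where "r = norm p + \<bar>B\<bar> + 1"
  define T where "T = (r + B) / norm w"
  have r: "norm p < r" by (simp add: r_def)
  have T: "0 \<le> T" unfolding T_def r_def by (intro divide_nonneg_nonneg) (auto simp: abs_real_def)
  have "(norm p + B) / norm w < T"
    unfolding T_def using w r by (simp add: divide_strict_right_mono)
  then have 0: "g (p + T *\<^sub>R w) = 0"
    using ray_point_outside[OF w order_refl, of p B T] B[of "p + T *\<^sub>R w"] by fastforce
  have "((\<lambda>t. frechet_derivative g (at (p + t *\<^sub>R w)) w) has_integral
      g (p + T *\<^sub>R w) - g (p + 0 *\<^sub>R w)) {0..T}"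
    using T by (intro fundamental_theorem_of_calculus)
      (auto simp flip: has_real_derivative_iff_has_vector_derivative
        intro!: frechet_derivative_has_real_derivative_along d)
  then have "integral {0..T} (\<lambda>t. frechet_derivative g (at (p + t *\<^sub>R w)) w) = - g p"
    using 0 by (simp add: integral_unique)
  then show ?thesis
    using ray_integral_cutoff[OF w less_imp_le[OF r], of "\<lambda>q. frechet_derivative g (at q) w" B] DB
    by (simp add: T_def)
qed

lemma continuous_on_ray_integral:
  fixes g :: "real \<times> real \<Rightarrow> real"
  assumes g: "continuous_on UNIV g" and w: "w \<noteq> 0" and B: "\<And>q. g q \<noteq> 0 \<Longrightarrow> norm q \<le> B"
  shows "continuous_on UNIV (ray_integral (\<lambda>_. w) g)"
proof -
  have "continuous_on (ball 0 r) (ray_integral (\<lambda>_. w) g)" for r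
  proof -
    define T where "T = (r + B) / norm w"
    have "continuous_on (ball 0 r) (\<lambda>p. integral (cbox 0 T) (\<lambda>t. g (p + t *\<^sub>R w)))"
      by (rule integral_continuous_on_param)
        (auto simp: case_prod_beta intro!: continuous_intros continuous_on_compose2[OF g])
    then show ?thesis
      by (rule continuous_on_eq) (auto simp: T_def intro!: ray_integral_cutoff[symmetric] w B)
  qed
  then have "isCont (ray_integral (\<lambda>_. w) g) p" for p
    using continuous_on_eq_continuous_at[of "ball 0 (norm p + 1)" "ray_integral (\<lambda>_. w) g"] by auto
  then show ?thesis by (simp add: continuous_at_imp_continuous_on)
qed

text \<open>Differentiation under the integral sign, on a ball around \<open>p\<close> where the
  upper limit is a fixed \<open>T\<close>. The common bound \<open>B\<close> for \<open>g\<close>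
  and its derivatives lets the same \<open>T\<close> cut off the integral of the derivative.\<close>

lemma has_derivative_ray_integral:
  fixes g :: "real \<times> real \<Rightarrow> real"
  assumes d: "\<And>q. g differentiable at q"
    and cont: "\<And>h. continuous_on UNIV (\<lambda>q. frechet_derivative g (at q) h)"
    and w: "w \<noteq> 0" and B: "\<And>q. g q \<noteq> 0 \<Longrightarrow> norm q \<le> B"
    and DB: "\<And>q h. frechet_derivative g (at q) h \<noteq> 0 \<Longrightarrow> norm q \<le> B"
  shows "(ray_integral (\<lambda>_. w) g has_derivative
           (\<lambda>h. ray_integral (\<lambda>_. w) (\<lambda>q. frechet_derivative g (at q) h) p)) (at p)"
proof -
  define r where "r = norm p + 1"
  define T where "T = (r + B) / norm w"
  \<comment> \<open>The Leibniz rule wants the derivative as a continuous family of bounded linear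
    maps. Assembled from the two partial derivatives, the family inherits its continuity from
    them.\<close>
  define G :: "real \<times> real \<Rightarrow> (real \<times> real) \<Rightarrow>\<^sub>L real" where "G q = (frechet_derivative g (at q) (1, 0)) *\<^sub>R Blinfun fst
      + (frechet_derivative g (at q) (0, 1)) *\<^sub>R Blinfun snd" for q
  have G: "blinfun_apply (G q) h = frechet_derivative g (at q) h" for q h
  proof -
    have "frechet_derivative g (at q) h = P_op (\<lambda>_. h) g q" by (simp add: P_op_const d)
    then show ?thesis
      by (simp add: G_def P_op_def grad_def inner_prod_def blinfun.add_left blinfun.scaleR_left
          bounded_linear_Blinfun_apply bounded_linear_fst bounded_linear_snd mult.commute)
  qed
  have Gc: "continuous_on UNIV G"
    unfolding G_def by (intro continuous_intros cont)
  have p: "p \<in> ball 0 r" by (simp add: r_def)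
  have "((\<lambda>x. integral (cbox 0 T) (\<lambda>t. g (x + t *\<^sub>R w))) has_derivative
      blinfun_apply (integral (cbox 0 T) (\<lambda>t. G (p + t *\<^sub>R w)))) (at p within ball 0 r)"
  proof (rule leibniz_rule)
    fix x t
    have "((\<lambda>x. x + t *\<^sub>R w) has_derivative (\<lambda>h. h)) (at x within ball 0 r)"
      by (auto intro!: derivative_eq_intros)
    moreover have "(g has_derivative blinfun_apply (G (x + t *\<^sub>R w))) (at (x + t *\<^sub>R w))"
      using d frechet_derivative_works unfolding G[abs_def] by blast
    ultimately show "((\<lambda>x. g (x + t *\<^sub>R w)) has_derivative blinfun_apply (G (x + t *\<^sub>R w)))
        (at x within ball 0 r)"
      by (rule has_derivative_compose)
  next
    fix x
    have gc: "continuous_on UNIV g"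
      using d by (simp add: continuous_at_imp_continuous_on differentiable_imp_continuous_within)
    show "(\<lambda>t. g (x + t *\<^sub>R w)) integrable_on cbox 0 T"
      by (intro integrable_continuous continuous_on_compose2[OF gc]) (auto intro!: continuous_intros)
  next
    show "continuous_on (ball 0 r \<times> cbox 0 T) (\<lambda>(x, t). G (x + t *\<^sub>R w))"
      by (auto simp: case_prod_beta intro!: continuous_intros continuous_on_compose2[OF Gc])
  qed (use p in auto)
  moreover have "blinfun_apply (integral (cbox 0 T) (\<lambda>t. G (p + t *\<^sub>R w)))
      = (\<lambda>h. ray_integral (\<lambda>_. w) (\<lambda>q. frechet_derivative g (at q) h) p)"
  proof
    fix h
    have "(\<lambda>t. G (p + t *\<^sub>R w)) integrable_on cbox 0 T"
      by (intro integrable_continuous continuous_on_compose2[OF Gc]) (auto intro!: continuous_intros)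
    then have "integral (cbox 0 T) ((\<lambda>F. blinfun_apply F h) \<circ> (\<lambda>t. G (p + t *\<^sub>R w)))
        = blinfun_apply (integral (cbox 0 T) (\<lambda>t. G (p + t *\<^sub>R w))) h"
      by (intro integral_linear blinfun.bounded_linear_left)
    then have "blinfun_apply (integral (cbox 0 T) (\<lambda>t. G (p + t *\<^sub>R w))) h
        = integral {0..T} (\<lambda>t. frechet_derivative g (at (p + t *\<^sub>R w)) h)"
      by (simp add: o_def G)
    also have "\<dots> = ray_integral (\<lambda>_. w) (\<lambda>q. frechet_derivative g (at q) h) p"
      unfolding T_def using p DB by (intro ray_integral_cutoff[symmetric] w) (auto simp: r_def)
    finally show "blinfun_apply (integral (cbox 0 T) (\<lambda>t. G (p + t *\<^sub>R w))) h
      = ray_integral (\<lambda>_. w) (\<lambda>q. frechet_derivative g (at q) h) p" .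
  qed
  ultimately have "((\<lambda>x. integral (cbox 0 T) (\<lambda>t. g (x + t *\<^sub>R w))) has_derivative
      (\<lambda>h. ray_integral (\<lambda>_. w) (\<lambda>q. frechet_derivative g (at q) h) p)) (at p)"
    using p at_within_open[OF p open_ball] by simp
  then show ?thesis
    by (rule has_derivative_transform_within_open[OF _ open_ball p])
      (auto simp: T_def intro!: ray_integral_cutoff[symmetric] w B)
qed

text \<open>Derivatives of a ray integral are ray integrals of derivatives, and these are again
  supported in the ball of radius \<open>B\<close>; hence the induction runs over all
  \<open>g\<close> with \<open>B\<close> fixed.\<close>

lemma Ck_ray_integral:
  fixes g :: "real \<times> real \<Rightarrow> real"
  assumes "Ck k g" and w: "w \<noteq> 0" and "supp g \<subseteq> cball 0 B"
  shows "Ck k (ray_integral (\<lambda>_. w) g)"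
  using assms(1,3)
proof (induction k arbitrary: g)
  case 0
  then show ?case using continuous_on_ray_integral[of g w B] w norm_le_if_supp_subset_cball by auto
next
  case (Suc k)
  note B = norm_le_if_supp_subset_cball[OF Suc.prems(2)]
    and DB = norm_le_if_frechet_derivative_neq_0[OF Suc.prems(2)]
  have d: "g differentiable at q" for q using Suc.prems(1) unfolding Ck.simps by blast
  have D: "Ck k (\<lambda>q. frechet_derivative g (at q) h)" for h using Suc.prems(1) unfolding Ck.simps by blast
  have der: "(ray_integral (\<lambda>_. w) g has_derivative
           (\<lambda>h. ray_integral (\<lambda>_. w) (\<lambda>q. frechet_derivative g (at q) h) p)) (at p)" for p
    by (rule has_derivative_ray_integral[where B = B]) (use d Ck_imp_continuous[OF D] w B DB in blast)+
  have "frechet_derivative (ray_integral (\<lambda>_. w) g) (at p) h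
      = ray_integral (\<lambda>_. w) (\<lambda>q. frechet_derivative g (at q) h) p" for p h
    using frechet_derivative_at[OF der] by metis
  moreover have "supp (\<lambda>q. frechet_derivative g (at q) h) \<subseteq> cball 0 B" for h
    unfolding supp_def using DB[of _ h] by (intro closure_minimal) auto
  ultimately have "Ck k (\<lambda>p. frechet_derivative (ray_integral (\<lambda>_. w) g) (at p) h)" for h
    using Suc.IH[OF D] by simp
  then show ?case
    using differentiableI[OF der] unfolding Ck.simps by blast
qed


section \<open>Vanishing and supports of ray integrals of smooth functions\<close>

lemma ray_integral_eq_0:
  assumes "\<And>t. 0 \<le> t \<Longrightarrow> g (p + t *\<^sub>R X p) = 0"
  shows "ray_integral X g p = 0"
proof -
  have "ray_integral X g p = integral {0..} (\<lambda>_::real. 0)"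
    unfolding ray_integral_def using assms by (intro Henstock_Kurzweil_Integration.integral_cong) auto
  then show ?thesis by simp
qed

lemma ray_integral_scale: "ray_integral X (\<lambda>q. c * g q) p = c * ray_integral X g p"
  by (simp add: ray_integral_def)

lemma supp_frechet_derivative_subset:
  fixes g :: "'a::real_normed_vector \<Rightarrow> real"
  shows "supp (\<lambda>q. frechet_derivative g (at q) h) \<subseteq> supp g"
proof -
  have "{p. frechet_derivative g (at p) h \<noteq> 0} \<subseteq> supp g"
    using frechet_derivative_eq_0_outside_supp by blast
  then show ?thesis
    by (metis closure_minimal closed_closure supp_def)
qed

context
  fixes g :: "real \<times> real \<Rightarrow> real" and w :: "real \<times> real" and B :: real
  assumes g: "smooth g" and supp: "supp g \<subseteq> cball 0 B" and w: "w \<noteq> 0"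
begin

lemma smooth_ray_integral: "smooth (ray_integral (\<lambda>_. w) g)"
  using g supp w Ck_ray_integral unfolding smooth_def by blast

lemma frechet_derivative_ray_integral:
  "frechet_derivative (ray_integral (\<lambda>_. w) g) (at p) h
    = ray_integral (\<lambda>_. w) (\<lambda>q. frechet_derivative g (at q) h) p"
proof -
  have "continuous_on UNIV (\<lambda>q. frechet_derivative g (at q) h)" for h
    using smooth_frechet_derivative[OF g] Ck_imp_continuous unfolding smooth_def by blast
  then have "(ray_integral (\<lambda>_. w) g has_derivative
           (\<lambda>h. ray_integral (\<lambda>_. w) (\<lambda>q. frechet_derivative g (at q) h) p)) (at p)"
    using norm_le_if_supp_subset_cball[OF supp] norm_le_if_frechet_derivative_neq_0[OF supp]
    by (intro has_derivative_ray_integral[where B = B] smooth_imp_differentiable[OF g] w)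
  from frechet_derivative_at[OF this] show ?thesis by metis
qed

lemma ray_integral_directional_derivative:
  "ray_integral (\<lambda>_. w) (\<lambda>q. frechet_derivative g (at q) w) p = - g p"
  using norm_le_if_supp_subset_cball[OF supp] norm_le_if_frechet_derivative_neq_0[OF supp]
  by (intro ray_integral_frechet_derivative[where B = B] smooth_imp_differentiable[OF g] w)

text \<open>Integrating along \<open>w\<close> and differentiating along \<open>w\<close> are
  inverse to each other up to sign, because the derivative passes under the integral.\<close>

lemma directional_derivative_ray_integral:
  "frechet_derivative (ray_integral (\<lambda>_. w) g) (at p) w = - g p"
  by (simp add: frechet_derivative_ray_integral ray_integral_directional_derivative)

text \<open>Along the upward ray from \<open>p\<close> the ray integral has derivative
  \<open>-g\<close>, which is zero until the axis is reached. So its value at \<open>p\<close>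
  equals its value at the crossing point.\<close>

lemma ray_integral_vanishes_below:
  assumes g0: "\<And>q. snd q \<le> 0 \<Longrightarrow> g q = 0" and up: "snd w > 0"
    and axis: "\<And>x. ray_integral (\<lambda>_. w) g (x, 0) = 0" and p: "snd p \<le> 0"
  shows "ray_integral (\<lambda>_. w) g p = 0"
proof (cases "snd p = 0")
  case True
  then show ?thesis using axis by (metis prod.collapse)
next
  case False
  define T where "T = - snd p / snd w"
  let ?R = "ray_integral (\<lambda>_. w) g"
  have T: "0 < T" unfolding T_def using p False up by (intro divide_pos_pos) auto
  have der: "((\<lambda>t. ?R (p + t *\<^sub>R w)) has_real_derivative - g (p + t *\<^sub>R w)) (at t within S)" for t S
    using frechet_derivative_has_real_derivative_along
      [OF smooth_imp_differentiable[OF smooth_ray_integral], where w = w]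
    by (simp add: directional_derivative_ray_integral)
  have 0: "g (p + t *\<^sub>R w) = 0" if "t < T" for t
    using that up by (intro g0) (simp add: T_def field_simps)
  have "?R (p + T *\<^sub>R w) = ?R (p + 0 *\<^sub>R w)"
  proof (intro DERIV_isconst_end[where f = "\<lambda>t. ?R (p + t *\<^sub>R w)"] T)
    show "continuous_on {0..T} (\<lambda>t. ?R (p + t *\<^sub>R w))"
      by (rule DERIV_continuous_on[OF der])
    show "((\<lambda>t. ?R (p + t *\<^sub>R w)) has_real_derivative 0) (at t)" if "t < T" for t
      using der[of t UNIV] 0[OF that] by simp
  qed
  moreover have "p + T *\<^sub>R w = (fst p + T * fst w, 0)"
    using up by (simp add: prod_eq_iff T_def)
  ultimately show ?thesis using axis by simp
qed

text \<open>A point with nonzero ray integral lies in the upper half-plane on a ray that meets the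
  support of the integrand, and the ray can only climb a bounded amount.\<close>

lemma supp_ray_integral_bounded:
  assumes up: "snd w > 0" and below: "\<And>p. snd p \<le> 0 \<Longrightarrow> ray_integral (\<lambda>_. w) g p = 0"
  shows "\<exists>C. supp (ray_integral (\<lambda>_. w) g) \<subseteq> cball 0 C"
proof -
  have "norm p \<le> B + B / snd w * norm w" if nz: "ray_integral (\<lambda>_. w) g p \<noteq> 0" for p
  proof -
    have "\<exists>t\<ge>0. g (p + t *\<^sub>R w) \<noteq> 0"
    proof (rule ccontr)
      assume "\<not> ?thesis"
      then have "ray_integral (\<lambda>_. w) g p = 0" by (intro ray_integral_eq_0) auto
      then show False using nz by simp
    qed
    then obtain t where t: "0 \<le> t" "g (p + t *\<^sub>R w) \<noteq> 0" by blast
    from t(2) have n: "norm (p + t *\<^sub>R w) \<le> B"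
      by (intro norm_le_if_supp_subset_cball[OF supp])
    have "snd p > 0" using below[of p] nz by linarith
    then have "t * snd w \<le> snd (p + t *\<^sub>R w)" by simp
    also have "\<dots> \<le> B" using n abs_snd_le_norm[of "p + t *\<^sub>R w"] by linarith
    finally have "t * norm w \<le> B / snd w * norm w"
      using up by (intro mult_right_mono) (auto simp: field_simps)
    then show ?thesis
      using n t(1) norm_triangle_ineq4[of "p + t *\<^sub>R w" "t *\<^sub>R w"] by simp
  qed
  then have "supp (ray_integral (\<lambda>_. w) g) \<subseteq> cball 0 (B + B / snd w * norm w)"
    unfolding supp_def by (intro closure_minimal) auto
  then show ?thesis by blast
qed

end

text \<open>The ray moves to the right, away from every point where \<open>g\<close> is
  nonzero.\<close>

lemma ray_integral_right_of_supp:
  assumes "\<And>q. g q \<noteq> 0 \<Longrightarrow> norm q \<le> B" "fst w > 0" "fst p > B"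
  shows "ray_integral (\<lambda>_. w) g p = 0"
proof (rule ray_integral_eq_0, rule ccontr)
  fix t assume t: "0 \<le> t" "g (p + t *\<^sub>R w) \<noteq> 0"
  then have "fst (p + t *\<^sub>R w) \<le> B"
    using assms(1)[OF t(2)] abs_fst_le_norm[of "p + t *\<^sub>R w"] by linarith
  moreover have "0 \<le> t * fst w" using t(1) assms(2) by simp
  ultimately show False using assms(3) by simp
qed

section \<open>From a potential to a vanishing transform\<close>

text \<open>Below the axis the derivative is zero since the support lies in the half-plane;
  continuity from below carries this to the axis.\<close>

lemma frechet_derivative_on_axis:
  assumes "\<phi> \<in> Cc_smooth half_plane"
  shows "frechet_derivative \<phi> (at (x, 0)) h = 0"
proof -
  let ?D = "\<lambda>q. frechet_derivative \<phi> (at q) h"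
  have s: "smooth \<phi>" "supp \<phi> \<subseteq> half_plane" using assms by (auto simp: Cc_smooth_def)
  have "continuous_on UNIV ?D"
    using smooth_frechet_derivative[OF s(1)] Ck_imp_continuous unfolding smooth_def by blast
  then have "continuous_on UNIV (\<lambda>y. ?D (x, y))"
    by (rule continuous_on_compose2) (auto intro!: continuous_intros)
  then have "isCont (\<lambda>y. ?D (x, y)) 0" by (simp add: continuous_on_eq_continuous_at)
  then have "((\<lambda>y. ?D (x, y)) \<longlongrightarrow> ?D (x, 0)) (at_left 0)"
    unfolding isCont_def by (rule filterlim_mono) (auto simp: at_le)
  moreover have "((\<lambda>y. ?D (x, y)) \<longlongrightarrow> 0) (at_left 0)"
  proof (rule tendsto_eventually, rule eventually_at_leftI[of "-1"])
    fix y :: real assume "y \<in> {-1<..<0}"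
    then have "(x, y) \<notin> supp \<phi>" using s(2) by (auto simp: half_plane_def)
    then show "?D (x, y) = 0" by (rule frechet_derivative_eq_0_outside_supp)
  qed simp
  ultimately show ?thesis by (metis tendsto_unique trivial_limit_at_left_real)
qed

text \<open>On the ray, \<open>f\<close> is the derivative along \<open>w\<close> of a multiple of a
  first derivative of \<phi>, so it integrates to minus the value of that multiple at the starting
  point, which is zero on the axis. The two formulas for \<open>f\<close> are instances with the
  fields exchanged.\<close>

lemma ray_integral_second_derivative_eq_0:
  assumes \<phi>: "\<phi> \<in> Cc_smooth half_plane" and w: "w \<noteq> 0" and up: "snd w > 0"
    and f: "\<And>p. p \<in> half_plane \<Longrightarrow>
      f p = P_op (\<lambda>_. w) (\<lambda>q. c * P_op (\<lambda>_. w') \<phi> q) p"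
  shows "ray_integral (\<lambda>_. w) f (x, 0) = 0"
proof -
  let ?D = "\<lambda>q. frechet_derivative \<phi> (at q) w'"
  have s: "smooth \<phi>" "compact (supp \<phi>)" using \<phi> by (auto simp: Cc_smooth_def)
  have P: "P_op (\<lambda>_. w') \<phi> q = ?D q" for q
    by (rule P_op_const) (rule smooth_imp_differentiable[OF s(1)])
  have sm: "smooth (\<lambda>q. c * ?D q)" by (intro smooth_scale smooth_frechet_derivative s)
  obtain B where B: "supp \<phi> \<subseteq> cball 0 B"
    using compact_imp_subset_cball[OF s(2)] by blast
  have "supp (\<lambda>q. c * ?D q) \<subseteq> supp ?D"
    unfolding supp_def by (intro closure_mono) auto
  then have B': "supp (\<lambda>q. c * ?D q) \<subseteq> cball 0 B"
    using B supp_frechet_derivative_subset by blast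
  have "f ((x, 0) + t *\<^sub>R w)
      = frechet_derivative (\<lambda>q. c * ?D q) (at ((x, 0) + t *\<^sub>R w)) w" if "t \<in> {0..}" for t
  proof -
    have "(x, 0) + t *\<^sub>R w \<in> half_plane"
      using that up by (simp add: half_plane_def mem_Times_iff)
    from f[OF this] show ?thesis
      unfolding P P_op_const[OF smooth_imp_differentiable[OF sm]] .
  qed
  then have "ray_integral (\<lambda>_. w) f (x, 0)
      = ray_integral (\<lambda>_. w) (\<lambda>p. frechet_derivative (\<lambda>q. c * ?D q) (at p) w) (x, 0)"
    unfolding ray_integral_def by (intro Henstock_Kurzweil_Integration.integral_cong) auto
  also have "\<dots> = - (c * ?D (x, 0))"
    by (rule ray_integral_directional_derivative[OF sm B' w])
  also have "\<dots> = 0" using frechet_derivative_on_axis[OF \<phi>] by simp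
  finally show ?thesis .
qed

section \<open>The iterated ray integral\<close>

text \<open>The derivative along \<open>a\<close> passes under the outer integral and there undoes
  the inner one.\<close>

lemma directional_derivative_double_ray_integral:
  assumes f: "smooth f" "supp f \<subseteq> cball 0 B"
    and g: "smooth (ray_integral (\<lambda>_. a) f)" "supp (ray_integral (\<lambda>_. a) f) \<subseteq> cball 0 C"
    and nz: "a \<noteq> 0" "b \<noteq> 0"
  shows "frechet_derivative (ray_integral (\<lambda>_. b) (ray_integral (\<lambda>_. a) f)) (at p) a
    = - ray_integral (\<lambda>_. b) f p"
  using frechet_derivative_ray_integral[OF g nz(2), of p a]
    directional_derivative_ray_integral[OF f nz(1)] ray_integral_scale[of "\<lambda>_. b" "-1" f p]
  by simp

lemma double_ray_integral_vanishes_below: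
  fixes f :: "real \<times> real \<Rightarrow> real"
  assumes f: "smooth f" "supp f \<subseteq> cball 0 B" and f0: "\<And>q. snd q \<le> 0 \<Longrightarrow> f q = 0"
    and g: "smooth (ray_integral (\<lambda>_. a) f)" "supp (ray_integral (\<lambda>_. a) f) \<subseteq> cball 0 B"
    and a: "fst a < 0" "snd a > 0" and b: "fst b > 0" "snd b > 0"
    and u0: "\<And>p. snd p \<le> 0 \<Longrightarrow> ray_integral (\<lambda>_. a) f p = 0"
    and v0: "\<And>p. snd p \<le> 0 \<Longrightarrow> ray_integral (\<lambda>_. b) f p = 0"
    and p: "snd p \<le> 0"
  shows "ray_integral (\<lambda>_. b) (ray_integral (\<lambda>_. a) f) p = 0"
proof -
  let ?g = "ray_integral (\<lambda>_. a) f"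
  let ?G = "ray_integral (\<lambda>_. b) ?g"
  have nz: "a \<noteq> 0" "b \<noteq> 0" using a b by auto
  have sm: "smooth ?G" by (rule smooth_ray_integral[OF g nz(2)])
  note d = smooth_imp_differentiable[OF sm]
  have Da: "frechet_derivative ?G (at q) a = - ray_integral (\<lambda>_. b) f q" for q
    using f g nz by (rule directional_derivative_double_ray_integral)
  have D0: "frechet_derivative ?G (at q) (1, 0) = 0" if q: "snd q \<le> 0" for q
  proof -
    have lin: "linear (frechet_derivative ?G (at q))"
      using d by (simp add: linear_frechet_derivative)
    have "fst a * snd b < 0 * 0 + snd a * fst b"
      using a b by (smt (verit) mult_neg_pos mult_pos_pos mult_zero_left)
    then have neq: "fst a * snd b - snd a * fst b \<noteq> 0" by simp
    \<comment> \<open>The second coordinates cancel in this combination, so the two known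
      derivatives determine the horizontal one; the signs of the components make the coefficient
      nonzero.\<close>
    have "(fst a * snd b - snd a * fst b) *\<^sub>R (1, 0) = snd b *\<^sub>R a - snd a *\<^sub>R b"
      by (simp add: prod_eq_iff algebra_simps)
    then have "(fst a * snd b - snd a * fst b) * frechet_derivative ?G (at q) (1, 0)
        = snd b * frechet_derivative ?G (at q) a - snd a * frechet_derivative ?G (at q) b"
      using linear_cmul[OF lin] linear_diff[OF lin] by (metis real_scaleR_def)
    also have "\<dots> = 0"
      using Da v0[OF q] u0[OF q] directional_derivative_ray_integral[OF g nz(2)] by simp
    finally show ?thesis using neq by simp
  qed
  have "((\<lambda>t. ?G (p + t *\<^sub>R (1, 0))) has_real_derivative 0) (at t)" for t :: real
    using frechet_derivative_has_real_derivative_along[OF d, of p "(1, 0)" t] D0 p by simp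
  then have const: "?G (p + t *\<^sub>R (1, 0)) = ?G (p + s *\<^sub>R (1, 0))" for t s :: real
    using DERIV_isconst_all by blast
  \<comment> \<open>The shifted point has first coordinate greater than \<open>B\<close>, and
    \<open>b\<close> points to the right.\<close>
  have "?G (p + (\<bar>B\<bar> + 1 - fst p) *\<^sub>R (1, 0)) = 0"
    using norm_le_if_supp_subset_cball[OF g(2)] b(1)
    by (rule ray_integral_right_of_supp) auto
  then show ?thesis using const[of "\<bar>B\<bar> + 1 - fst p" 0] by (simp flip: zero_prod_def)
qed

section \<open>The equivalence\<close>

theorem theorem4:
  fixes u v :: "real \<Rightarrow> real \<times> real"
    and U V :: "real \<times> real \<Rightarrow> real \<times> real"
    and f :: "real \<times> real \<Rightarrow> real"
  assumes "smooth u" and "smooth v"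
    and "\<And>x. u x \<in> sphere 0 1" and "\<And>x. v x \<in> sphere 0 1"
    and "\<And>x. fst (u x) < 0" and "\<And>x. snd (u x) > 0"
    and "\<And>x. fst (v x) > 0" and "\<And>x. snd (v x) > 0"
    and "smooth U" and "smooth V"
    and "\<And>x. U (x, 0) = u x" and "\<And>x. V (x, 0) = v x"
    and "straight_integral_curves U" and "straight_integral_curves V"
    and "\<And>p. U p \<noteq> V p \<and> independent {U p, V p}"
    and "f \<in> Cc_smooth half_plane" and "supp f \<subseteq> {p. snd p > 0}"
    and "\<And>p. p \<in> half_plane \<Longrightarrow>
           divergence U p * ray_integral U f p - divergence V p * ray_integral V f p = 0"
  shows "(\<forall>(x, d) \<in> half_plane. head_wave_transform U V f x d = 0) \<longleftrightarrow>
         (\<exists>\<phi> \<in> Cc_smooth half_plane.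
            (\<forall>x. \<phi> (x, 0) = 0) \<and>
            (\<forall>p \<in> half_plane. f p = P_op U (\<lambda>q. inverse (det (A_mat U V q)) * P_op V \<phi> q) p) \<and>
            (\<forall>p \<in> half_plane. f p = P_op V (\<lambda>q. inverse (det (A_mat U V q)) * P_op U \<phi> q) p))"
proof -
  define a where "a = u 0"
  define b where "b = v 0"
  have a: "fst a < 0" "snd a > 0" and b: "fst b > 0" "snd b > 0"
    using assms(5-8) by (auto simp: a_def b_def)
  have nz: "a \<noteq> 0" "b \<noteq> 0" using a b by auto
  have "U p \<noteq> 0" "V p \<noteq> 0" for p
    using assms(15)[of p] by (metis dependent_zero insertI1 insertI2)+
  moreover have "norm (U (x, 0)) = 1" "norm (V (x, 0)) = 1" for x
    using assms(3,4)[of x] assms(11,12) by simp_all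
  moreover have "snd (U (x, 0)) > 0" "snd (V (x, 0)) > 0" for x
    using assms(6,8)[of x] assms(11,12) by simp_all
  ultimately have "U = (\<lambda>_. U (0, 0))" "V = (\<lambda>_. V (0, 0))"
    by (intro straight_integral_curves_const assms(13,14); blast)+
  then have U: "U = (\<lambda>_. a)" and V: "V = (\<lambda>_. b)"
    by (simp_all add: a_def b_def assms(11,12))
  define D where "D = fst a * snd b - fst b * snd a"
  have det: "det (A_mat U V q) = D" for q
    by (simp add: A_mat_def U V D_def det_2)
  have "fst a * snd b < 0" "fst b * snd a > 0"
    using a b by (simp_all add: mult_neg_pos)
  then have D: "D \<noteq> 0" by (simp add: D_def)
  have f: "smooth f" "compact (supp f)" using assms(16) by (auto simp: Cc_smooth_def)
  have f0: "f q = 0" if "snd q \<le> 0" for q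
    using that assms(17) eq_0_outside_supp[of q f] by fastforce
  \<comment> \<open>The middle integral runs along the axis, where \<open>f\<close>
    vanishes.\<close>
  have "head_wave_transform U V f x d
      = ray_integral (\<lambda>_. a) f (x, 0) + ray_integral (\<lambda>_. b) f (x + d, 0)" for x d
    by (simp add: head_wave_transform_def U V f0)
  then have head: "(\<forall>(x, d) \<in> half_plane. head_wave_transform U V f x d = 0) \<longleftrightarrow>
      (\<forall>x d. d \<ge> 0 \<longrightarrow> ray_integral (\<lambda>_. a) f (x, 0) + ray_integral (\<lambda>_. b) f (x + d, 0) = 0)"
    by (auto simp: half_plane_def)
  show ?thesis
    unfolding head det unfolding U V
  proof (intro iffI allI impI)
    assume "\<exists>\<phi> \<in> Cc_smooth half_plane.
            (\<forall>x. \<phi> (x, 0) = 0) \<and>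
            (\<forall>p \<in> half_plane. f p = P_op (\<lambda>_. a) (\<lambda>q. inverse D * P_op (\<lambda>_. b) \<phi> q) p) \<and>
            (\<forall>p \<in> half_plane. f p = P_op (\<lambda>_. b) (\<lambda>q. inverse D * P_op (\<lambda>_. a) \<phi> q) p)"
    then obtain \<phi> where \<phi>: "\<phi> \<in> Cc_smooth half_plane"
      and fa: "\<And>p. p \<in> half_plane \<Longrightarrow> f p = P_op (\<lambda>_. a) (\<lambda>q. inverse D * P_op (\<lambda>_. b) \<phi> q) p"
      and fb: "\<And>p. p \<in> half_plane \<Longrightarrow> f p = P_op (\<lambda>_. b) (\<lambda>q. inverse D * P_op (\<lambda>_. a) \<phi> q) p"
      by blast
    show "ray_integral (\<lambda>_. a) f (x, 0) + ray_integral (\<lambda>_. b) f (x + d, 0) = 0" for x d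
      using ray_integral_second_derivative_eq_0[OF \<phi> nz(1) a(2) fa]
        ray_integral_second_derivative_eq_0[OF \<phi> nz(2) b(2) fb] by simp
  next
    assume R: "\<forall>x d. d \<ge> 0 \<longrightarrow>
      ray_integral (\<lambda>_. a) f (x, 0) + ray_integral (\<lambda>_. b) f (x + d, 0) = 0"
    obtain B where B: "supp f \<subseteq> cball 0 B"
      using compact_imp_subset_cball[OF f(2)] by blast
    \<comment> \<open>The shift is an admissible \<open>d\<close>: it is nonnegative and moves
      \<open>x\<close> beyond \<open>B\<close>, so only the integral along \<open>a\<close> remains.
      Taking \<open>d = 0\<close> afterwards isolates the one along \<open>b\<close>.\<close>
    have "ray_integral (\<lambda>_. b) f (x + \<bar>B - x\<bar> + 1, 0) = 0" for x
      using norm_le_if_supp_subset_cball[OF B] b(1) by (rule ray_integral_right_of_supp) auto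
    then have axis_a: "ray_integral (\<lambda>_. a) f (x, 0) = 0" for x
      using R[rule_format, of "\<bar>B - x\<bar> + 1" x] by (simp add: add.assoc)
    then have axis_b: "ray_integral (\<lambda>_. b) f (x, 0) = 0" for x
      using R[rule_format, of 0 x] by simp
    let ?g = "ray_integral (\<lambda>_. a) f"
    have below_a: "?g p = 0" if "snd p \<le> 0" for p
      by (rule ray_integral_vanishes_below[OF f(1) B nz(1) f0 a(2) axis_a that])
    have below_b: "ray_integral (\<lambda>_. b) f p = 0" if "snd p \<le> 0" for p
      by (rule ray_integral_vanishes_below[OF f(1) B nz(2) f0 b(2) axis_b that])
    have g: "smooth ?g" by (rule smooth_ray_integral[OF f(1) B nz(1)])
    obtain C where C: "supp ?g \<subseteq> cball 0 C"
      using supp_ray_integral_bounded[OF f(1) B nz(1) a(2) below_a] by blast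
    \<comment> \<open>A common radius, since the vanishing result for the iterated integral takes
      one ball for both supports.\<close>
    define M where "M = max B C"
    have fM: "supp f \<subseteq> cball 0 M" and gM: "supp ?g \<subseteq> cball 0 M"
      using B C by (auto simp: M_def)
    let ?G = "ray_integral (\<lambda>_. b) ?g"
    have below: "?G p = 0" if "snd p \<le> 0" for p
      by (rule double_ray_integral_vanishes_below[OF f(1) fM f0 g gM a b below_a below_b that])
    have G: "smooth ?G" by (rule smooth_ray_integral[OF g gM nz(2)])
    obtain E where E: "supp ?G \<subseteq> cball 0 E"
      using supp_ray_integral_bounded[OF g gM nz(2) b(2) below] by blast
    \<comment> \<open>The factor \<open>D\<close> cancels \<open>inverse D\<close>, so each inner
      operator leaves the negative of a single ray integral of \<open>f\<close>, from which the
      outer operator recovers \<open>f\<close>.\<close>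
    define \<phi> where "\<phi> = (\<lambda>p. D * ?G p)"
    have \<phi>: "smooth \<phi>" unfolding \<phi>_def by (rule smooth_scale[OF G])
    have supp_eq: "supp \<phi> = supp ?G" using D by (simp add: \<phi>_def supp_def)
    have "{p. ?G p \<noteq> 0} \<subseteq> half_plane"
    proof
      fix p assume "p \<in> {p. ?G p \<noteq> 0}"
      then show "p \<in> half_plane"
        using below[of p] by (cases "snd p \<le> 0") (auto simp: half_plane_def mem_Times_iff)
    qed
    then have "supp ?G \<subseteq> half_plane"
      unfolding supp_def half_plane_def by (intro closure_minimal closed_Times) auto
    moreover have "compact (supp ?G)"
      using E bounded_subset[OF bounded_cball E] by (simp add: supp_def compact_eq_bounded_closed)
    ultimately have mem: "\<phi> \<in> Cc_smooth half_plane"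
      using \<phi> supp_eq by (simp add: Cc_smooth_def)
    \<comment> \<open>The sign is written as a factor \<open>-1\<close> to fit the scaling lemmas
      used in \<open>Pw\<close>.\<close>
    have Pb: "inverse D * P_op (\<lambda>_. b) \<phi> q = -1 * ?g q" for q
      using D directional_derivative_ray_integral[OF g gM nz(2), of q]
      by (simp add: P_op_const smooth_imp_differentiable[OF \<phi>])
        (simp add: \<phi>_def frechet_derivative_scale smooth_imp_differentiable[OF G])
    have Da: "frechet_derivative ?G (at q) a = - ray_integral (\<lambda>_. b) f q" for q
      using f(1) B g gM nz by (rule directional_derivative_double_ray_integral)
    have Pa: "inverse D * P_op (\<lambda>_. a) \<phi> q = -1 * ray_integral (\<lambda>_. b) f q" for q
      using D Da[of q]
      by (simp add: P_op_const smooth_imp_differentiable[OF \<phi>])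
        (simp add: \<phi>_def frechet_derivative_scale smooth_imp_differentiable[OF G])
    have Pw: "P_op (\<lambda>_. w) (\<lambda>q. -1 * ray_integral (\<lambda>_. w) f q) p = f p" if w: "w \<noteq> 0" for w p
    proof -
      note s = smooth_ray_integral[OF f(1) B w]
      have "P_op (\<lambda>_. w) (\<lambda>q. -1 * ray_integral (\<lambda>_. w) f q) p
          = frechet_derivative (\<lambda>q. -1 * ray_integral (\<lambda>_. w) f q) (at p) w"
        by (rule P_op_const[OF smooth_imp_differentiable[OF smooth_scale[OF s]]])
      also have "\<dots> = -1 * frechet_derivative (ray_integral (\<lambda>_. w) f) (at p) w"
        by (rule frechet_derivative_scale[OF smooth_imp_differentiable[OF s]])
      also have "\<dots> = f p" using directional_derivative_ray_integral[OF f(1) B w] by simp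
      finally show ?thesis .
    qed
    show "\<exists>\<phi> \<in> Cc_smooth half_plane.
            (\<forall>x. \<phi> (x, 0) = 0) \<and>
            (\<forall>p \<in> half_plane. f p = P_op (\<lambda>_. a) (\<lambda>q. inverse D * P_op (\<lambda>_. b) \<phi> q) p) \<and>
            (\<forall>p \<in> half_plane. f p = P_op (\<lambda>_. b) (\<lambda>q. inverse D * P_op (\<lambda>_. a) \<phi> q) p)"
      using mem Pw[OF nz(1)] Pw[OF nz(2)] below
      by (intro bexI[of _ \<phi>]) (simp_all add: Pa[abs_def] Pb[abs_def] \<phi>_def[THEN fun_cong])
  qed
qed

end
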